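(* Let $T:\mathcal H\to\mathcal H$ be a non-expansive operator on a real Hilbert space with $\mathrm{fix}\,T\neq\emptyset$, let $\lambda_k\in(0,1]$, $\varepsilon_k\in\mathcal H$, and let $(z_k)_{k\in\mathbb N}$ be generated from $z_0\in\mathcal H$ by $z_{k+1}=z_k+\lambda_k(Tz_k+\varepsilon_k-z_k)$. Suppose that $C_2=\sum_{k\in\mathbb N}\lambda_k\|\varepsilon_k\|<+\infty$. Then for all $k\in\mathbb N$ $$\|\bar e_k\|\le\frac{2(d_0+C_2)}{\Lambda_k}.$$ In particular, if $\inf_{k\in\mathbb N}\lambda_k>0$, then $\|\bar e_k\|=O(1/k)$.
   Context: $\mathrm{fix}\,T=\{z:z=Tz\}$; $e_k=(\mathrm{Id}-T)z_k$; $\Lambda_k=\sum_{j=0}^k\lambda_j$; $\bar e_k=\frac1{\Lambda_k}\sum_{j=0}^k\lambda_je_j$; $d_0=\inf_{z\in\mathrm{fix}\,T}\|z_0-z\|$. $\mathbb N$ is the set of non-negative integers. *)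

theory Defs
  imports "HOL-Analysis.Analysis" "HOL-Library.Landau_Symbols"
begin

definition fix_set :: "('a \<Rightarrow> 'a) \<Rightarrow> 'a set" where
  "fix_set T = {z. z = T z}"

definition residual :: "('a::real_vector \<Rightarrow> 'a) \<Rightarrow> (nat \<Rightarrow> 'a) \<Rightarrow> nat \<Rightarrow> 'a" where
  "residual T z k = z k - T (z k)"

definition cum_weight :: "(nat \<Rightarrow> real) \<Rightarrow> nat \<Rightarrow> real" where
  "cum_weight l k = (\<Sum>j=0..k. l j)"

definition ergodic_residual ::
  "('a::real_vector \<Rightarrow> 'a) \<Rightarrow> (nat \<Rightarrow> real) \<Rightarrow> (nat \<Rightarrow> 'a) \<Rightarrow> nat \<Rightarrow> 'a" where
  "ergodic_residual T l z k =
     (1 / cum_weight l k) *\<^sub>R (\<Sum>j=0..k. l j *\<^sub>R residual T z j)"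

text \<open>The infimum is taken in the reals, so it is meaningful only for a nonempty fixed point set.\<close>
definition dist_fix :: "('a::real_normed_vector \<Rightarrow> 'a) \<Rightarrow> 'a \<Rightarrow> real" where
  "dist_fix T x = (INF z\<in>fix_set T. norm (x - z))"

definition inexact_KM ::
  "('a::real_vector \<Rightarrow> 'a) \<Rightarrow> (nat \<Rightarrow> real) \<Rightarrow> (nat \<Rightarrow> 'a) \<Rightarrow> (nat \<Rightarrow> 'a) \<Rightarrow> bool" where
  "inexact_KM T l \<epsilon> z \<longleftrightarrow>
     (\<forall>k. z (Suc k) = z k + l k *\<^sub>R (T (z k) + \<epsilon> k - z k))"

end

theory Submission
  imports Defs
begin

text \<open>
  The recursion says that each weighted residual \<open>l j *\<^sub>R residual T z j\<close> is the step
  \<open>z j - z (Suc j)\<close> up to the weighted error. Hence the sum of the weighted residuals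
  telescopes to \<open>z 0 - z (Suc k)\<close> plus the sum of the weighted errors
  (\<open>weighted_residuals_telescope\<close>), and it is enough to bound the displacement
  \<open>z 0 - z (Suc k)\<close>.

  That displacement is controlled through a fixed point \<open>p\<close>: the exact relaxed step does not
  increase the distance to \<open>p\<close>, so the distance grows at most by the weighted error norms
  (\<open>inexact_KM_quasi_Fejer\<close>). The triangle inequality through \<open>p\<close> uses the initial distance
  twice, and the errors enter once from the telescoped sum and once from the growth of the
  distance; this is the factor 2. Taking the infimum over \<open>p\<close> yields \<open>dist_fix\<close>. The rate follows
  because weights bounded below by \<open>c > 0\<close> have partial sums of at least \<open>c * k\<close>.
\<close>

lemma weighted_residuals_telescope:
  fixes z \<epsilon> :: "nat \<Rightarrow> 'a::real_vector"
  assumes "inexact_KM T l \<epsilon> z"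
  shows "(\<Sum>j=0..k. l j *\<^sub>R residual T z j)
           = z 0 - z (Suc k) + (\<Sum>j=0..k. l j *\<^sub>R \<epsilon> j)"
proof -
  have "l j *\<^sub>R residual T z j = z j - z (Suc j) + l j *\<^sub>R \<epsilon> j" for j
    using assms by (simp add: inexact_KM_def residual_def algebra_simps)
  then have "(\<Sum>j=0..k. l j *\<^sub>R residual T z j)
               = (\<Sum>j\<le>k. z j - z (Suc j)) + (\<Sum>j=0..k. l j *\<^sub>R \<epsilon> j)"
    by (simp add: sum.distrib atLeast0AtMost)
  then show ?thesis
    by (simp only: sum_telescope)
qed

text \<open>
  The exact relaxed step is a convex combination of \<open>z k\<close> and \<open>T (z k)\<close>, both of which lie within
  distance \<open>norm (z k - p)\<close> of \<open>p\<close>; only the error can therefore move the iterate further away.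
\<close>

lemma inexact_KM_step_distance:
  fixes T :: "'a::real_normed_vector \<Rightarrow> 'a"
  assumes nonexpansive: "1-lipschitz_on UNIV T"
    and p: "p \<in> fix_set T"
    and relax: "l k \<in> {0..1}"
    and iter: "inexact_KM T l \<epsilon> z"
  shows "norm (z (Suc k) - p) \<le> norm (z k - p) + l k * norm (\<epsilon> k)"
proof -
  have "T p = p"
    using p by (simp add: fix_set_def)
  then have T: "norm (T (z k) - p) \<le> norm (z k - p)"
    using lipschitz_onD[OF nonexpansive, of "z k" p] by (simp add: dist_norm)
  have "z (Suc k) - p = (1 - l k) *\<^sub>R (z k - p) + l k *\<^sub>R (T (z k) - p) + l k *\<^sub>R \<epsilon> k"
    using iter by (simp add: inexact_KM_def algebra_simps)
  also have "norm \<dots> \<le> (1 - l k) * norm (z k - p) + l k * norm (T (z k) - p) + l k * norm (\<epsilon> k)"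
    using relax by (intro norm_triangle_le add_mono order_refl) auto
  also have "\<dots> \<le> (1 - l k) * norm (z k - p) + l k * norm (z k - p) + l k * norm (\<epsilon> k)"
    using relax T by (intro add_mono mult_left_mono) auto
  finally show ?thesis
    by (simp add: algebra_simps)
qed

lemma inexact_KM_quasi_Fejer:
  fixes T :: "'a::real_normed_vector \<Rightarrow> 'a"
  assumes "1-lipschitz_on UNIV T"
    and "p \<in> fix_set T"
    and "\<And>k. l k \<in> {0..1}"
    and "inexact_KM T l \<epsilon> z"
  shows "norm (z n - p) \<le> norm (z 0 - p) + (\<Sum>j<n. l j * norm (\<epsilon> j))"
proof (induction n)
  case (Suc n)
  then show ?case
    using inexact_KM_step_distance[of T p l n \<epsilon> z] assms by simp
qed simp

lemma norm_weighted_residuals_le: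
  fixes T :: "'a::real_normed_vector \<Rightarrow> 'a"
  assumes nonexpansive: "1-lipschitz_on UNIV T"
    and fix_nonempty: "fix_set T \<noteq> {}"
    and relax: "\<And>k. l k \<in> {0..1}"
    and iter: "inexact_KM T l \<epsilon> z"
  shows "norm (\<Sum>j=0..k. l j *\<^sub>R residual T z j)
           \<le> 2 * (dist_fix T (z 0) + (\<Sum>j\<le>k. l j * norm (\<epsilon> j)))"
    (is "norm ?R \<le> 2 * (_ + ?E)")
proof -
  have "norm ?R / 2 - ?E \<le> norm (z 0 - p)" if "p \<in> fix_set T" for p
  proof -
    have "norm (\<Sum>j=0..k. l j *\<^sub>R \<epsilon> j) \<le> ?E"
      using relax by (intro sum_norm_le[THEN order_trans]) (auto simp: atLeast0AtMost)
    moreover have "norm (z (Suc k) - p) \<le> norm (z 0 - p) + ?E"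
      using inexact_KM_quasi_Fejer[OF nonexpansive that relax iter, of "Suc k"]
      by (simp add: lessThan_Suc_atMost)
    moreover have "norm (z 0 - z (Suc k)) \<le> norm (z 0 - p) + norm (z (Suc k) - p)"
      by (metis dist_norm dist_triangle2)
    moreover have "norm ?R \<le> norm (z 0 - z (Suc k)) + norm (\<Sum>j=0..k. l j *\<^sub>R \<epsilon> j)"
      unfolding weighted_residuals_telescope[OF iter] by (rule norm_triangle_ineq)
    ultimately show ?thesis
      by simp
  qed
  then have "norm ?R / 2 - ?E \<le> dist_fix T (z 0)"
    unfolding dist_fix_def by (intro cINF_greatest fix_nonempty)
  then show ?thesis
    by simp
qed

lemma cum_weight_ge_linear:
  assumes "\<And>j. c \<le> l j"
  shows "real (Suc k) * c \<le> cum_weight l k"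
  using sum_bounded_below[of "{0..k}" c l] assms by (simp add: cum_weight_def)

theorem theorem2:
  fixes T :: "'a::{real_inner, complete_space} \<Rightarrow> 'a"
    and l :: "nat \<Rightarrow> real"
    and \<epsilon> z :: "nat \<Rightarrow> 'a"
  assumes nonexpansive: "1-lipschitz_on UNIV T"
    and fix_nonempty: "fix_set T \<noteq> {}"
    and relax: "\<And>k. l k \<in> {0<..1}"
    and iter: "inexact_KM T l \<epsilon> z"
    and summable_err: "summable (\<lambda>k. l k * norm (\<epsilon> k))"
  shows "(\<forall>k. norm (ergodic_residual T l z k)
            \<le> 2 * (dist_fix T (z 0) + (\<Sum>k. l k * norm (\<epsilon> k))) / cum_weight l k)
       \<and> ((INF k. l k) > 0 \<longrightarrow>
            (\<lambda>k. norm (ergodic_residual T l z k)) \<in> O(\<lambda>k. 1 / real k))"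
proof -
  define C where "C = 2 * (dist_fix T (z 0) + (\<Sum>k. l k * norm (\<epsilon> k)))"
  have l_pos: "0 < l k" and l01: "l k \<in> {0..1}" for k
    using relax[of k] by auto
  have weight_pos: "0 < cum_weight l k" for k
    unfolding cum_weight_def using l_pos by (intro sum_pos) auto
  have residuals: "norm (\<Sum>j=0..k. l j *\<^sub>R residual T z j) \<le> C" for k
  proof -
    have "(\<Sum>j\<le>k. l j * norm (\<epsilon> j)) \<le> (\<Sum>j. l j * norm (\<epsilon> j))"
      using l_pos by (intro sum_le_suminf summable_err) (auto simp: less_imp_le)
    then show ?thesis
      using norm_weighted_residuals_le[OF nonexpansive fix_nonempty l01 iter, of k]
      by (simp add: C_def)
  qed
  then have C_nonneg: "0 \<le> C"
    using norm_ge_zero order_trans by blast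
  have bound: "norm (ergodic_residual T l z k) \<le> C / cum_weight l k" for k
    using divide_right_mono[OF residuals, of "cum_weight l k" k] weight_pos[of k]
    by (simp add: ergodic_residual_def)
  have "(\<lambda>k. norm (ergodic_residual T l z k)) \<in> O(\<lambda>k. 1 / real k)" if "(INF k. l k) > 0"
  proof -
    define c where "c = (INF k. l k)"
    have "bdd_below (range l)"
      using l_pos by (intro bdd_belowI[of _ 0]) (auto simp: less_imp_le)
    then have c: "c \<le> l j" for j
      unfolding c_def by (intro cINF_lower) auto
    have rate: "norm (ergodic_residual T l z k) \<le> C / c * (1 / real k)" if "k > 0" for k
    proof -
      have "real k * c \<le> real (Suc k) * c"
        using \<open>(INF k. l k) > 0\<close> by (simp add: c_def)
      also have "\<dots> \<le> cum_weight l k"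
        using c by (rule cum_weight_ge_linear)
      finally have "C / cum_weight l k \<le> C / (real k * c)"
        using C_nonneg that \<open>(INF k. l k) > 0\<close> by (intro divide_left_mono) (auto simp: c_def weight_pos)
      then show ?thesis
        using bound[of k] by (simp add: mult.commute)
    qed
    show ?thesis
      by (rule bigoI[of _ "C / c"], rule eventually_mono[OF eventually_gt_at_top[of 0]])
        (use rate in simp)
  qed
  with bound show ?thesis
    by (simp add: C_def)
qed

end
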